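(* Let $\mathscr{X}$ be a finite non-empty state space and consider any imprecise Markov chain $\mathscr{P}_{\mathcal{M},\mathscr{T}}$ with initial model $\mathcal{M}$ and set of transition matrices $\mathscr{T}$. Let $\{g_n\}_{n\in\mathbb{N}_0}$ and $\{h_n\}_{n\in\mathbb{N}}$ be two sequences of functions in $\mathscr{L}(\mathscr{X})$. Define $\tau_1(x_1):=g_0(x_1)$ for all $x_1\in\mathscr{X}$ and, for all $n\in\mathbb{N}$, $$\tau_{n+1}(x_{1:n+1}) := h_n(x_1)\,\tau_n(x_{2:n+1}) + g_n(x_1)\quad\text{for all } x_{1:n+1}\in\mathscr{X}^{n+1}.$$ Let $\{\overline{\Upsilon}_n\}_{n\in\mathbb{N}}$ and $\{\underline{\Upsilon}_n\}_{n\in\mathbb{N}}$ be the sequences of functions in $\mathscr{L}(\mathscr{X})$ defined by $\overline{\Upsilon}_n(x):=\overline{\mathrm{E}}_{\mathcal{M},\mathscr{T}}(\tau_n(X_{1:n})\mid X_1=x)$ and $\underline{\Upsilon}_n(x):=\underline{\mathrm{E}}_{\mathcal{M},\mathscr{T}}(\tau_n(X_{1:n})\mid X_1=x)$ for all $x\in\mathscr{X}$ and all $n\in\mathbb{N}$. Then $$\begin{cases} \overline{\Upsilon}_1=\underline{\Upsilon}_1=g_0;\\ \overline{\Upsilon}_{n+1}=h_n\,\mathbb{I}_{h_n\geq 0}\,[\overline{T}\,\overline{\Upsilon}_n]+h_n\,\mathbb{I}_{h_n<0}\,[\underline{T}\,\underline{\Upsilon}_n]+g_n\quad\text{for all } n\in\mathbb{N};\\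 \underline{\Upsilon}_{n+1}=h_n\,\mathbb{I}_{h_n\geq 0}\,[\underline{T}\,\underline{\Upsilon}_n]+h_n\,\mathbb{I}_{h_n<0}\,[\overline{T}\,\overline{\Upsilon}_n]+g_n\quad\text{for all } n\in\mathbb{N}, \end{cases}$$ where all sums and products of functions are pointwise.
   Context: $\mathbb{N}=\{1,2,\dots\}$ and $\mathbb{N}_0=\mathbb{N}\cup\{0\}$. $\mathscr{X}$ is a finite non-empty set (state space); $\mathscr{L}(\mathscr{X}^n)$ is the set of all functions $\mathscr{X}^n\to\mathbb{R}$. Paths are elements $\omega$ of $\Omega:=\mathscr{X}^{\mathbb{N}}$; $X_n(\omega):=\omega_n$, $X_{m:n}(\omega):=\omega_{m:n}=(\omega_m,\dots,\omega_n)$ for $m\le n$, and $x_{m:n}$ denotes $(x_m,\dots,x_n)\in\mathscr{X}^{n-m+1}$. For $f$ on $\mathscr{X}^{n-m+1}$, $f(X_{m:n}):=f\circ X_{m:n}$. Stochastic process: a model $\mathrm{P}$ is specified by a probability mass function $\mathrm{P}(X_1)$ on $\mathscr{X}$ together with, for every $n\in\mathbb{N}$ and every $x_{1:n}\in\mathscr{X}^n$, a probability mass function $\mathrm{P}(X_{n+1}\mid X_{1:n}=x_{1:n})$ on $\mathscr{X}$ (specified also for histories of probability zero). For $1\le m\le n$, $f\in\mathscr{L}(\mathscr{X}^n)$ and $x_{1:m}\in\mathscr{X}^m$, $$\mathrm{E}_{\mathrm{P}}(f(X_{1:n})\mid X_{1:m}=x_{1:m})=\sum_{x_{m+1:n}\in\mathscr{X}^{n-m}}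 f(x_{1:n})\prod_{k=m}^{n-1}\mathrm{P}(X_{k+1}=x_{k+1}\mid X_{1:k}=x_{1:k}).$$ Imprecise Markov chain: $\mathcal{M}$ is a non-empty set of probability mass functions on $\mathscr{X}$. $\mathscr{T}$ is a non-empty set of row-stochastic $|\mathscr{X}|\times|\mathscr{X}|$ matrices with separately specified rows: there are non-empty sets $\mathscr{T}_x$ ($x\in\mathscr{X}$) of probability mass functions on $\mathscr{X}$ such that $\mathscr{T}$ is the set of all row-stochastic matrices $T$ with $T(x,\cdot)\in\mathscr{T}_x$ for all $x\in\mathscr{X}$. $\mathscr{P}_{\mathcal{M},\mathscr{T}}$ is the set of all models $\mathrm{P}$ such that $\mathrm{P}(X_1)\in\mathcal{M}$ and, for all $n\in\mathbb{N}$ and $x_{1:n}\in\mathscr{X}^n$, there is some $T\in\mathscr{T}$ with $\mathrm{P}(X_{n+1}=x_{n+1}\mid X_{1:n}=x_{1:n})=T(x_n,x_{n+1})$ for all $x_{n+1}\in\mathscr{X}$ (neither the Markov property nor homogeneity is required of $\mathrm{P}$). Upper and lower expectations: $\overline{\mathrm{E}}_{\mathcal{M},\mathscr{T}}(f\mid C):=\sup_{\mathrm{P}\in\mathscr{P}_{\mathcal{M},\mathscr{T}}}\mathrm{E}_{\mathrm{P}}(f\mid C)$ and $\underline{\mathrm{E}}_{\mathcal{M},\mathscr{T}}(f\mid C):=\inf_{\mathrm{P}\in\mathscr{P}_{\mathcal{M},\mathscr{T}}}\mathrm{E}_{\mathrm{P}}(f\mid C)$. Transition operators on $\mathscr{L}(\mathscr{X})$: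 $[\overline{T}f](x):=\sup_{T(x,\cdot)\in\mathscr{T}_x}\sum_{y\in\mathscr{X}}T(x,y)f(y)$ and $[\underline{T}f](x):=-[\overline{T}(-f)](x)$ for all $f\in\mathscr{L}(\mathscr{X})$, $x\in\mathscr{X}$. $\mathbb{I}_{h_n\ge 0}$ and $\mathbb{I}_{h_n<0}$ denote the indicator functions on $\mathscr{X}$ of $\{x\in\mathscr{X}: h_n(x)\ge 0\}$ and $\{x\in\mathscr{X}: h_n(x)<0\}$. *)

theory Defs
  imports "HOL-Probability.Probability_Mass_Function"
begin

text \<open>
  The finite non-empty state space is a type \<open>'a\<close> of class \<open>finite\<close>, and a tuple
  \<open>x\<^sub>1, \<dots>, x\<^sub>n\<close> of states is a list of length \<open>n\<close>; its entry \<open>x\<^sub>k\<^sub>+\<^sub>1\<close> is the list element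
  with index \<open>k\<close>.
  A function on \<open>n\<close>-tuples is a function on lists of which only the values on lists of
  length \<open>n\<close> are used.
  A row-stochastic matrix \<open>T\<close> is given by its rows: \<open>T x\<close> is the probability mass function
  in row \<open>x\<close>, so its entry at \<open>(x, y)\<close> is \<open>pmf (T x) y\<close>.
\<close>

text \<open>
  \<open>trans P xs\<close> is the mass function of the state that follows the history \<open>xs\<close>. Histories
  are non-empty; the value \<open>trans P []\<close> has no meaning and is never used.
\<close>

record 'a model =
  init :: "'a pmf"
  trans :: "'a list \<Rightarrow> 'a pmf"

text \<open>
  \<open>cond_exp P f n xs\<close> is the expectation of \<open>f\<close> applied to the first \<open>n\<close> states, conditional on
  the first \<open>length xs\<close> states being \<open>xs\<close>. It is meant for \<open>1 \<le> length xs \<le> n\<close>.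
\<close>

definition cond_exp ::
    "'a::finite model \<Rightarrow> ('a list \<Rightarrow> real) \<Rightarrow> nat \<Rightarrow> 'a list \<Rightarrow> real" where
  "cond_exp P f n xs =
    (\<Sum>ys | length ys = n - length xs.
       f (xs @ ys) *
       (\<Prod>k = length xs..<n. pmf (trans P (take k (xs @ ys))) ((xs @ ys) ! k)))"

definition matrices_with_rows :: "('a \<Rightarrow> 'a pmf set) \<Rightarrow> ('a \<Rightarrow> 'a pmf) set" where
  "matrices_with_rows R = {T. \<forall>x. T x \<in> R x}"

definition imprecise_Markov_chain ::
    "'a pmf set \<Rightarrow> ('a \<Rightarrow> 'a pmf) set \<Rightarrow> 'a model set" where
  "imprecise_Markov_chain M TT =
    {P. init P \<in> M \<and>
        (\<forall>xs. xs \<noteq> [] \<longrightarrow> (\<exists>T\<in>TT. \<forall>y. pmf (trans P xs) y = pmf (T (last xs)) y))}"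

text \<open>
  The state space is finite, so the suprema and infima below are over bounded sets of reals;
  these sets are non-empty when \<open>M\<close>, \<open>TT\<close> and all \<open>R x\<close> are.
\<close>

definition upper_exp ::
    "'a::finite pmf set \<Rightarrow> ('a \<Rightarrow> 'a pmf) set \<Rightarrow> ('a list \<Rightarrow> real) \<Rightarrow> nat \<Rightarrow> 'a list \<Rightarrow> real" where
  "upper_exp M TT f n xs = (SUP P\<in>imprecise_Markov_chain M TT. cond_exp P f n xs)"

definition lower_exp ::
    "'a::finite pmf set \<Rightarrow> ('a \<Rightarrow> 'a pmf) set \<Rightarrow> ('a list \<Rightarrow> real) \<Rightarrow> nat \<Rightarrow> 'a list \<Rightarrow> real" where
  "lower_exp M TT f n xs = (INF P\<in>imprecise_Markov_chain M TT. cond_exp P f n xs)"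

definition upper_trans :: "('a::finite \<Rightarrow> 'a pmf set) \<Rightarrow> ('a \<Rightarrow> real) \<Rightarrow> 'a \<Rightarrow> real" where
  "upper_trans R f x = (SUP p\<in>R x. \<Sum>y\<in>UNIV. pmf p y * f y)"

definition lower_trans :: "('a::finite \<Rightarrow> 'a pmf set) \<Rightarrow> ('a \<Rightarrow> real) \<Rightarrow> 'a \<Rightarrow> real" where
  "lower_trans R f x = - upper_trans R (\<lambda>y. - f y) x"

end

theory Submission
  imports Defs
begin

text \<open>
  Conditional on the first state, the expectation of a function of a path obeys the tower law:
  average over the second state the expectation given the first two states. The latter is an
  expectation, given one state, in the model whose histories have the first state stripped off
  (\<open>time_shift\<close>). Since the admissible mass functions depend only on the last state of the
  history, stripping stays inside the imprecise Markov chain; conversely, a row for the first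
  step and one model for each second state can be glued together into a single
  model of the chain, because different histories are unconstrained by each other. Hence the
  supremum over all models splits into a supremum over the first row and suprema over the models
  that continue from each second state. This is the law of iterated upper expectations,
  \<open>upper_exp_Suc\<close>.

  Apply it to \<open>\<tau> (n + 1)\<close>. Given the first state \<open>x\<close> this is an affine function of \<open>\<tau> n\<close> with
  slope \<open>h n x\<close>; upper expectations commute with affine maps of nonnegative slope and turn into
  lower ones when the slope is negative. This gives the recursion for \<open>U\<close>
  (\<open>upper_exp_recursion\<close>). The recursion for \<open>L\<close> is the same statement for \<open>- \<tau>\<close> and \<open>- g\<close> with
  unchanged \<open>h\<close>, by the conjugacy of lower and upper expectations.
\<close>

section \<open>Conditional expectations in a single model\<close>

lemma finite_lists_of_length [simp]: "finite {ys :: 'a::finite list. length ys = m}"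
  using finite_lists_length_eq[of "UNIV :: 'a set" m] by simp

lemma sum_lists_Suc:
  fixes F :: "'a::finite list \<Rightarrow> real"
  shows "(\<Sum>ys | length ys = Suc m. F ys) = (\<Sum>y\<in>UNIV. \<Sum>zs | length zs = m. F (y # zs))"
proof -
  have img: "{ys :: 'a list. length ys = Suc m}
      = (\<lambda>(y, zs). y # zs) ` (UNIV \<times> {zs. length zs = m})"
    by (auto simp: length_Suc_conv)
  have "inj_on (\<lambda>(y :: 'a, zs). y # zs) (UNIV \<times> {zs. length zs = m})"
    by (auto simp: inj_on_def)
  then have "(\<Sum>ys | length ys = Suc m. F ys)
      = (\<Sum>(y, zs)\<in>UNIV \<times> {zs. length zs = m}. F (y # zs))"
    unfolding img by (subst sum.reindex) (auto simp: case_prod_beta)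
  then show ?thesis
    by (simp add: sum.cartesian_product)
qed

text \<open>
  The first of the remaining factors, at index \<open>length xs\<close>, depends on the remaining states
  only through the next one, so the sum over that state can be pulled out.
\<close>

lemma cond_exp_tower:
  assumes "length xs < n"
  shows "cond_exp P f n xs = (\<Sum>y\<in>UNIV. pmf (trans P xs) y * cond_exp P f n (xs @ [y]))"
proof -
  obtain m where m: "n - length xs = Suc m" "n - Suc (length xs) = m"
    using assms by (metis Suc_diff_Suc)
  show ?thesis
    unfolding cond_exp_def using assms
    by (simp add: m sum_lists_Suc sum_distrib_left prod.atLeast_Suc_lessThan mult_ac
        del: diff_Suc_Suc)
qed

definition time_shift :: "'a \<Rightarrow> 'a model \<Rightarrow> 'a model" where
  "time_shift x P = \<lparr>init = init P, trans = (\<lambda>xs. trans P (x # xs))\<rparr>"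

lemma trans_time_shift [simp]: "trans (time_shift x P) xs = trans P (x # xs)"
  by (simp add: time_shift_def)

lemma cond_exp_Cons:
  "cond_exp P f (Suc n) (x # xs) = cond_exp (time_shift x P) (\<lambda>ys. f (x # ys)) n xs"
  unfolding cond_exp_def by (simp add: prod.shift_bounds_Suc_ivl del: prod.op_ivl_Suc)

lemma cond_exp_cong:
  assumes "\<And>ys. length ys = n \<Longrightarrow> f ys = f' ys" and "length xs \<le> n"
  shows "cond_exp P f n xs = cond_exp P f' n xs"
  unfolding cond_exp_def using assms by (intro sum.cong) auto

lemma cond_exp_cong_model:
  assumes "\<And>ys. trans P (y # ys) = trans Q (y # ys)"
  shows "cond_exp P f n [y] = cond_exp Q f n [y]"
proof -
  have "trans P (take k (y # ys)) = trans Q (take k (y # ys))" if "1 \<le> k" for k ys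
    using that assms by (cases k) auto
  then show ?thesis
    unfolding cond_exp_def by (auto intro!: sum.cong prod.cong)
qed

lemma sum_pmf_UNIV [simp]: "(\<Sum>y\<in>UNIV. pmf (p :: 'a::finite pmf) y) = 1"
  by (rule sum_pmf_eq_1) auto

lemma cond_exp_const:
  assumes "length xs \<le> n"
  shows "cond_exp P (\<lambda>_. c) n xs = c"
  using assms
proof (induction "n - length xs" arbitrary: xs)
  case 0
  then show ?case by (simp add: cond_exp_def)
next
  case (Suc d)
  then have "cond_exp P (\<lambda>_. c) n (xs @ [y]) = c" for y
    by simp
  with Suc show ?case
    by (simp add: cond_exp_tower flip: sum_distrib_right)
qed

lemma cond_exp_affine:
  assumes "length xs \<le> n"
  shows "cond_exp P (\<lambda>ys. a * f ys + b) n xs = a * cond_exp P f n xs + b"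
proof -
  have "cond_exp P (\<lambda>ys. a * f ys + b) n xs = a * cond_exp P f n xs + cond_exp P (\<lambda>_. b) n xs"
    unfolding cond_exp_def by (simp add: algebra_simps sum.distrib sum_distrib_left)
  then show ?thesis
    using assms by (simp add: cond_exp_const)
qed

text \<open>
  All products of transition probabilities are at most 1. The bound is the same for every
  model, so the suprema over models are taken over bounded sets.
\<close>

lemma cond_exp_le:
  "cond_exp P f n xs \<le> (\<Sum>ys | length ys = n - length xs. \<bar>f (xs @ ys)\<bar>)"
  unfolding cond_exp_def
proof (intro sum_mono)
  fix ys :: "'a list"
  define \<pi> where "\<pi> = (\<Prod>k = length xs..<n. pmf (trans P (take k (xs @ ys))) ((xs @ ys) ! k))"
  have "0 \<le> \<pi>" "\<pi> \<le> 1"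
    unfolding \<pi>_def by (auto intro!: prod_nonneg prod_le_1 simp: pmf_le_1)
  then have "\<bar>f (xs @ ys) * \<pi>\<bar> \<le> \<bar>f (xs @ ys)\<bar>"
    by (simp add: abs_mult mult_left_le)
  then show "f (xs @ ys) * \<pi> \<le> \<bar>f (xs @ ys)\<bar>"
    by linarith
qed

section \<open>Suprema and affine maps\<close>

lemma SUP_affine:
  fixes F :: "'b \<Rightarrow> real"
  assumes "A \<noteq> {}" and "bdd_above (F ` A)" and "0 \<le> a"
  shows "(SUP i\<in>A. a * F i + b) = a * (SUP i\<in>A. F i) + b"
proof -
  have "a * Sup (F ` A) + b = (SUP s\<in>F ` A. a * s + b)"
    using assms by (intro continuous_at_Sup_mono)
      (auto intro!: monoI mult_left_mono continuous_intros)
  then show ?thesis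
    by (simp add: image_image)
qed

lemma upper_trans_bdd:
  "bdd_above ((\<lambda>p. \<Sum>y\<in>UNIV. pmf (p :: 'a::finite pmf) y * f y) ` A)"
proof (rule bdd_aboveI2)
  show "(\<Sum>y\<in>UNIV. pmf p y * f y) \<le> (\<Sum>y\<in>UNIV. \<bar>f y\<bar>)" for p :: "'a pmf"
  proof (intro sum_mono)
    fix y
    have "\<bar>pmf p y * f y\<bar> \<le> \<bar>f y\<bar>"
      by (simp add: abs_mult mult_left_le_one_le pmf_le_1)
    then show "pmf p y * f y \<le> \<bar>f y\<bar>"
      by linarith
  qed
qed

lemma upper_trans_affine:
  assumes "R x \<noteq> {}" and "0 \<le> a"
  shows "upper_trans R (\<lambda>y. a * f y + b) x = a * upper_trans R f x + b"
proof -
  have "(\<Sum>y\<in>UNIV. pmf p y * (a * f y + b)) = a * (\<Sum>y\<in>UNIV. pmf p y * f y) + b"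
    for p :: "'a pmf"
    by (simp add: algebra_simps sum.distrib flip: sum_distrib_left)
  then show ?thesis
    unfolding upper_trans_def using assms by (simp add: SUP_affine upper_trans_bdd)
qed

lemma upper_trans_affine_neg:
  assumes "R x \<noteq> {}" and "a \<le> 0"
  shows "upper_trans R (\<lambda>y. a * f y + b) x = a * lower_trans R f x + b"
  using upper_trans_affine[of R x "- a" "\<lambda>y. - f y" b] assms by (simp add: lower_trans_def)

section \<open>Upper expectations in the imprecise Markov chain\<close>

context
  fixes M :: "'a::finite pmf set" and R :: "'a \<Rightarrow> 'a pmf set"
  assumes M_nonempty: "M \<noteq> {}" and R_nonempty: "\<And>x. R x \<noteq> {}"
begin

abbreviation "chain \<equiv> imprecise_Markov_chain M (matrices_with_rows R)"
abbreviation "upper \<equiv> upper_exp M (matrices_with_rows R)"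
abbreviation "lower \<equiv> lower_exp M (matrices_with_rows R)"

text \<open>
  Because rows are separately specified, a single admissible row extends to an admissible matrix.
\<close>

lemma in_chain_iff:
  "P \<in> chain \<longleftrightarrow> init P \<in> M \<and> (\<forall>xs. xs \<noteq> [] \<longrightarrow> trans P xs \<in> R (last xs))"
proof -
  have "(\<exists>T\<in>matrices_with_rows R. \<forall>y. pmf p y = pmf (T z) y) \<longleftrightarrow> p \<in> R z" for p z
  proof
    assume "p \<in> R z"
    then have "(\<lambda>x. SOME q. q \<in> R x)(z := p) \<in> matrices_with_rows R"
      using R_nonempty by (auto simp: matrices_with_rows_def some_in_eq)
    then show "\<exists>T\<in>matrices_with_rows R. \<forall>y. pmf p y = pmf (T z) y"
      by (rule rev_bexI) simp
  next
    assume "\<exists>T\<in>matrices_with_rows R. \<forall>y. pmf p y = pmf (T z) y"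
    then show "p \<in> R z"
      by (auto simp: matrices_with_rows_def simp flip: pmf_eq_iff)
  qed
  then show ?thesis
    by (simp add: imprecise_Markov_chain_def)
qed

lemma chain_nonempty: "chain \<noteq> {}"
proof -
  obtain \<mu> where "\<mu> \<in> M"
    using M_nonempty by blast
  then have "\<lparr>init = \<mu>, trans = (\<lambda>xs. SOME q. q \<in> R (last xs))\<rparr> \<in> chain"
    using R_nonempty by (simp add: in_chain_iff some_in_eq)
  then show ?thesis
    by blast
qed

lemma time_shift_in_chain:
  assumes "P \<in> chain"
  shows "time_shift x P \<in> chain"
  unfolding in_chain_iff
proof (intro conjI allI impI)
  show "init (time_shift x P) \<in> M"
    using assms by (simp add: in_chain_iff time_shift_def)
  show "trans (time_shift x P) xs \<in> R (last xs)" if "xs \<noteq> []" for xs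
  proof -
    have "trans P (x # xs) \<in> R (last (x # xs))"
      using assms by (simp only: in_chain_iff) blast
    with that show ?thesis
      by simp
  qed
qed

text \<open>
  Membership in the chain is a separate condition on each history, on its last state only, and
  the histories used by the different \<open>Q y\<close> after the step from \<open>x\<close> are disjoint: the second
  state tells them apart. So the prescribed pieces never conflict.
\<close>

lemma glue_models:
  assumes "p \<in> R x" and "\<And>y. Q y \<in> chain"
  obtains P where "P \<in> chain" and "trans P [x] = p"
    and "\<And>y ys. trans P (x # y # ys) = trans (Q y) (y # ys)"
proof -
  obtain \<mu> where "\<mu> \<in> M"
    using M_nonempty by blast
  \<comment> \<open>First steps from states other than \<open>x\<close> must be admissible too.\<close>
  define s where "s = (\<lambda>z. SOME q. q \<in> R z)(x := p)"
  have s: "s z \<in> R z" for z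
    using assms(1) R_nonempty by (simp add: s_def some_in_eq)
  define P where "P = \<lparr>init = \<mu>, trans = (\<lambda>xs. if tl xs = [] then s (hd xs)
      else trans (Q (hd (tl xs))) (tl xs))\<rparr>"
  have "trans P xs \<in> R (last xs)" if "xs \<noteq> []" for xs
  proof (cases "tl xs = []")
    case True
    with that obtain z where "xs = [z]"
      by (cases xs) auto
    then show ?thesis
      using s by (simp add: P_def)
  next
    case False
    then have "trans (Q (hd (tl xs))) (tl xs) \<in> R (last (tl xs))"
      using assms(2) by (simp add: in_chain_iff)
    with False show ?thesis
      by (simp add: P_def last_tl)
  qed
  with \<open>\<mu> \<in> M\<close> have "P \<in> chain"
    by (simp add: in_chain_iff) (simp add: P_def)
  then show ?thesis
    by (rule that) (simp_all add: P_def s_def)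
qed

lemma bdd_above_cond_exp: "bdd_above ((\<lambda>P. cond_exp P f n xs) ` A)"
  by (rule bdd_aboveI2) (rule cond_exp_le)

lemma cond_exp_le_upper: "P \<in> chain \<Longrightarrow> cond_exp P f n xs \<le> upper f n xs"
  unfolding upper_exp_def by (rule cSUP_upper) (auto intro: bdd_above_cond_exp)

lemma lower_eq_uminus_upper: "lower f n xs = - upper (\<lambda>ys. - f ys) n xs"
proof -
  have "cond_exp P (\<lambda>ys. - f ys) n xs = - cond_exp P f n xs" for P
    by (simp add: cond_exp_def sum_negf)
  then show ?thesis
    by (simp add: lower_exp_def upper_exp_def Inf_real_def image_image)
qed

lemma upper_affine:
  assumes "length xs \<le> n" and "0 \<le> a"
  shows "upper (\<lambda>ys. a * f ys + b) n xs = a * upper f n xs + b"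
  unfolding upper_exp_def using assms chain_nonempty
  by (simp add: cond_exp_affine SUP_affine bdd_above_cond_exp)

lemma upper_affine_neg:
  assumes "length xs \<le> n" and "a \<le> 0"
  shows "upper (\<lambda>ys. a * f ys + b) n xs = a * lower f n xs + b"
  using upper_affine[of xs n "- a" "\<lambda>ys. - f ys" b] assms by (simp add: lower_eq_uminus_upper)

text \<open>
  The upper bound averages the suprema over the continuations after each second state. It is
  reached because \<open>glue_models\<close> lets a single model be nearly optimal after every second state
  at once.
\<close>

lemma upper_exp_Suc:
  assumes "1 \<le> n"
  shows "upper f (Suc n) [x] = upper_trans R (\<lambda>y. upper (\<lambda>ys. f (x # ys)) n [y]) x"
proof (rule antisym)
  define f' where "f' = (\<lambda>ys. f (x # ys))"
  have step: "cond_exp P f (Suc n) [x]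
      = (\<Sum>y\<in>UNIV. pmf (trans P [x]) y * cond_exp (time_shift x P) f' n [y])" for P
    using assms cond_exp_tower[of "[x]" "Suc n" P f] by (simp add: cond_exp_Cons[of _ _ _ _ "[_]"] f'_def)

  have "cond_exp P f (Suc n) [x] \<le> upper_trans R (\<lambda>y. upper f' n [y]) x" if P: "P \<in> chain" for P
  proof -
    have "trans P [x] \<in> R (last [x])"
      using P by (simp only: in_chain_iff) blast
    then have "trans P [x] \<in> R x"
      by simp
    have "cond_exp P f (Suc n) [x] \<le> (\<Sum>y\<in>UNIV. pmf (trans P [x]) y * upper f' n [y])"
      unfolding step
      by (intro sum_mono mult_left_mono cond_exp_le_upper time_shift_in_chain P) simp
    also have "\<dots> \<le> upper_trans R (\<lambda>y. upper f' n [y]) x"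
      unfolding upper_trans_def
      by (intro cSUP_upper upper_trans_bdd) fact
    finally show ?thesis .
  qed
  then show "upper f (Suc n) [x] \<le> upper_trans R (\<lambda>y. upper (\<lambda>ys. f (x # ys)) n [y]) x"
    unfolding upper_exp_def[of _ _ f] f'_def[symmetric] by (intro cSUP_least chain_nonempty)

  have "(\<Sum>y\<in>UNIV. pmf p y * upper f' n [y]) \<le> upper f (Suc n) [x]" if p: "p \<in> R x" for p
  proof (rule field_le_epsilon)
    fix e :: real
    assume "0 < e"
    \<comment> \<open>The suprema need not be attained, so each continuation is chosen up to \<open>e\<close>.\<close>
    have "\<exists>Q\<in>chain. upper f' n [y] - e < cond_exp Q f' n [y]" for y
      using less_cSUP_iff[OF chain_nonempty bdd_above_cond_exp, of "upper f' n [y] - e" f' n "[y]"]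
        \<open>0 < e\<close> by (simp add: upper_exp_def)
    then obtain Q where Q: "\<And>y. Q y \<in> chain"
      and near: "\<And>y. upper f' n [y] - e < cond_exp (Q y) f' n [y]"
      by metis
    obtain P where P: "P \<in> chain" "trans P [x] = p"
      and cont: "\<And>y ys. trans P (x # y # ys) = trans (Q y) (y # ys)"
      using glue_models[where Q = Q] p Q by metis
    have "cond_exp (time_shift x P) f' n [y] = cond_exp (Q y) f' n [y]" for y
      by (rule cond_exp_cong_model) (simp add: cont)
    then have "cond_exp P f (Suc n) [x] = (\<Sum>y\<in>UNIV. pmf p y * cond_exp (Q y) f' n [y])"
      using P by (simp add: step)
    moreover have "(\<Sum>y\<in>UNIV. pmf p y * upper f' n [y])
        \<le> (\<Sum>y\<in>UNIV. pmf p y * (cond_exp (Q y) f' n [y] + e))"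
      using near by (intro sum_mono mult_left_mono) (auto simp: diff_less_eq intro: less_imp_le)
    moreover have "\<dots> = (\<Sum>y\<in>UNIV. pmf p y * cond_exp (Q y) f' n [y]) + e"
      by (simp add: algebra_simps sum.distrib flip: sum_distrib_left)
    ultimately show "(\<Sum>y\<in>UNIV. pmf p y * upper f' n [y]) \<le> upper f (Suc n) [x] + e"
      using cond_exp_le_upper[OF P(1), of f "Suc n" "[x]"] by linarith
  qed
  then show "upper_trans R (\<lambda>y. upper (\<lambda>ys. f (x # ys)) n [y]) x \<le> upper f (Suc n) [x]"
    unfolding upper_trans_def f'_def[symmetric] by (intro cSUP_least R_nonempty)
qed

text \<open>
  The sign of \<open>a\<close> is fixed once \<open>x\<close> is, so the inner upper expectations (after each second
  state) and the outer one (over the first row) turn into lower ones together. Hence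
  \<open>upper_trans\<close> never meets \<open>lower\<close>.
\<close>

lemma upper_exp_recursion:
  assumes "1 \<le> n" and "\<And>ys. length ys = n \<Longrightarrow> f (x # ys) = a * f' ys + b"
  shows "upper f (Suc n) [x] =
    a * (if 0 \<le> a then upper_trans R (\<lambda>y. upper f' n [y]) x
         else lower_trans R (\<lambda>y. lower f' n [y]) x) + b"
proof -
  have "upper (\<lambda>ys. f (x # ys)) n [y] = upper (\<lambda>ys. a * f' ys + b) n [y]" for y
    unfolding upper_exp_def using assms by (intro SUP_cong cond_exp_cong) auto
  then have "upper f (Suc n) [x] = upper_trans R (\<lambda>y. upper (\<lambda>ys. a * f' ys + b) n [y]) x"
    using assms(1) by (simp add: upper_exp_Suc)
  then show ?thesis
    using assms(1) R_nonempty
    by (simp add: upper_affine upper_affine_neg upper_trans_affine upper_trans_affine_neg)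
qed

text \<open>
  This is \<open>upper_exp_recursion\<close> for \<open>- f\<close>, \<open>- f'\<close> and \<open>- b\<close>; the slope \<open>a\<close> keeps its sign.
\<close>

lemma lower_exp_recursion:
  assumes "1 \<le> n" and "\<And>ys. length ys = n \<Longrightarrow> f (x # ys) = a * f' ys + b"
  shows "lower f (Suc n) [x] =
    a * (if 0 \<le> a then lower_trans R (\<lambda>y. lower f' n [y]) x
         else upper_trans R (\<lambda>y. upper f' n [y]) x) + b"
  using upper_exp_recursion[of n "\<lambda>ys. - f ys" x a "\<lambda>ys. - f' ys" "- b"] assms
  by (simp add: lower_eq_uminus_upper lower_trans_def)

end

section \<open>The recursion\<close>

theorem theorem2:
  fixes M :: "'a::finite pmf set"
    and R :: "'a \<Rightarrow> 'a pmf set"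
    and TT :: "('a \<Rightarrow> 'a pmf) set"
    and g h :: "nat \<Rightarrow> 'a \<Rightarrow> real"
    and \<tau> :: "nat \<Rightarrow> 'a list \<Rightarrow> real"
    and U L :: "nat \<Rightarrow> 'a \<Rightarrow> real"
  assumes "M \<noteq> {}"
    and "\<And>x. R x \<noteq> {}"
    and "TT = matrices_with_rows R"
    and "\<And>x. \<tau> 1 [x] = g 0 x"
    and "\<And>n x xs. n \<ge> 1 \<Longrightarrow> length xs = n \<Longrightarrow> \<tau> (n + 1) (x # xs) = h n x * \<tau> n xs + g n x"
    and "\<And>n x. n \<ge> 1 \<Longrightarrow> U n x = upper_exp M TT (\<tau> n) n [x]"
    and "\<And>n x. n \<ge> 1 \<Longrightarrow> L n x = lower_exp M TT (\<tau> n) n [x]"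
  shows "U 1 = g 0 \<and> L 1 = g 0 \<and>
    (\<forall>n\<ge>1. U (n + 1) =
      (\<lambda>x. h n x * indicator {x. h n x \<ge> 0} x * upper_trans R (U n) x
         + h n x * indicator {x. h n x < 0} x * lower_trans R (L n) x + g n x)) \<and>
    (\<forall>n\<ge>1. L (n + 1) =
      (\<lambda>x. h n x * indicator {x. h n x \<ge> 0} x * lower_trans R (L n) x
         + h n x * indicator {x. h n x < 0} x * upper_trans R (U n) x + g n x))"
proof -
  have U: "U n = (\<lambda>y. upper_exp M (matrices_with_rows R) (\<tau> n) n [y])"
    and L: "L n = (\<lambda>y. lower_exp M (matrices_with_rows R) (\<tau> n) n [y])" if "n \<ge> 1" for n
    using assms(3,6,7) that by auto
  have \<tau>: "\<tau> (Suc n) (x # ys) = h n x * \<tau> n ys + g n x" if "1 \<le> n" "length ys = n" for n x ys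
    using assms(5)[OF that] by simp
  have "cond_exp P (\<tau> 1) 1 [x] = g 0 x" for P x
    using assms(4) by (simp add: cond_exp_def)
  then have "U 1 = g 0" "L 1 = g 0"
    using chain_nonempty[OF assms(1,2)]
    by (simp_all add: U L upper_exp_def lower_exp_def fun_eq_iff)
  moreover have "U (n + 1) =
      (\<lambda>x. h n x * indicator {x. h n x \<ge> 0} x * upper_trans R (U n) x
         + h n x * indicator {x. h n x < 0} x * lower_trans R (L n) x + g n x)"
    if n: "n \<ge> 1" for n
  proof
    fix x
    show "U (n + 1) x = h n x * indicator {x. h n x \<ge> 0} x * upper_trans R (U n) x
         + h n x * indicator {x. h n x < 0} x * lower_trans R (L n) x + g n x"
      using upper_exp_recursion[OF assms(1,2) n, where f = "\<tau> (Suc n)" and x = x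
          and a = "h n x" and f' = "\<tau> n" and b = "g n x"] \<tau>[OF n] n
      by (simp add: U L indicator_def)
  qed
  moreover have "L (n + 1) =
      (\<lambda>x. h n x * indicator {x. h n x \<ge> 0} x * lower_trans R (L n) x
         + h n x * indicator {x. h n x < 0} x * upper_trans R (U n) x + g n x)"
    if n: "n \<ge> 1" for n
  proof
    fix x
    show "L (n + 1) x = h n x * indicator {x. h n x \<ge> 0} x * lower_trans R (L n) x
         + h n x * indicator {x. h n x < 0} x * upper_trans R (U n) x + g n x"
      using lower_exp_recursion[OF assms(1,2) n, where f = "\<tau> (Suc n)" and x = x
          and a = "h n x" and f' = "\<tau> n" and b = "g n x"] \<tau>[OF n] n
      by (simp add: U L indicator_def)
  qed
  ultimately show ?thesis
    by blast
qed

end
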